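(* Let $K$ be a compact modest semilattice. Then $C_p(K,2)$ is $\sigma$-discrete, i.e. it is the union of countably many subsets each of which is discrete in its subspace topology.
   Context: A semilattice is a partially ordered set $(S,\le)$ with a minimal element $0$ in which every two elements $x,y$ have a greatest lower bound $x\wedge y$. A topological semilattice is a semilattice carrying a Hausdorff topology for which $\wedge\colon S\times S\to S$ is continuous; it is a compact semilattice if this topology is compact. An element $p$ of a semilattice $S$ is called compact if for every $A\subseteq S$ whose supremum exists and satisfies $\sup A=p$ there is a finite $A_0\subseteq A$ with $\sup A_0=p$ (in particular $0$ is compact). An element $x$ is an immediate predecessor of $p$ if $x<p$ and there is no $y$ with $x<y<p$; $p^-$ denotes the set of all immediate predecessors of $p$. A compact semilattice $K$ is modest if its topology is totally disconnected and for every compact element $p\in K$ the set $p^-$ is finite. $C_p(K,2)$ is the set of all continuous functions $K\to 2=\{0,1\}$ (with $\{0,1\}$ discrete), endowed with the topology of pointwise convergence on $K$. *)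

theory Defs
  imports "HOL-Analysis.Analysis" "HOL-Library.Lub_Glb"
begin

text \<open>
  A semilattice \<open>K\<close> is modelled as a type of class \<open>{semilattice_inf, order_bot}\<close>: the minimal
  element \<open>0\<close> is \<open>bot\<close> (in the presence of binary meets, minimal elements are least).
  Together with class \<open>t2_space\<close> this provides a Hausdorff topology; no compatibility between
  order and topology is implied by these classes, so continuity of the meet is required explicitly.
\<close>

definition compact_semilattice :: "'a::{semilattice_inf, order_bot, t2_space} itself \<Rightarrow> bool"
  where "compact_semilattice _ \<longleftrightarrow>
    continuous_on UNIV (\<lambda>(x::'a, y::'a). inf x y) \<and> compact (UNIV :: 'a set)"

text \<open>Here \<open>isLub UNIV A p\<close> says that the supremum of \<open>A\<close> in the whole order exists and equals \<open>p\<close>.\<close>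

definition compact_element :: "'a::order \<Rightarrow> bool"
  where "compact_element p \<longleftrightarrow>
    (\<forall>A. isLub UNIV A p \<longrightarrow> (\<exists>A\<^sub>0\<subseteq>A. finite A\<^sub>0 \<and> isLub UNIV A\<^sub>0 p))"

definition immediate_predecessors :: "'a::order \<Rightarrow> 'a set"
  where "immediate_predecessors p = {x. x < p \<and> (\<nexists>y. x < y \<and> y < p)}"

definition totally_disconnected :: "'a::topological_space set \<Rightarrow> bool"
  where "totally_disconnected S \<longleftrightarrow> (\<forall>C\<subseteq>S. connected C \<longrightarrow> (\<exists>x. C \<subseteq> {x}))"

definition compact_modest_semilattice ::
    "'a::{semilattice_inf, order_bot, t2_space} itself \<Rightarrow> bool"
  where "compact_modest_semilattice _ \<longleftrightarrow>
    compact_semilattice TYPE('a) \<and>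
    totally_disconnected (UNIV :: 'a set) \<and>
    (\<forall>p::'a. compact_element p \<longrightarrow> finite (immediate_predecessors p))"

text \<open>
  The two-point space \<open>2\<close> is \<open>bool\<close>, whose topology is discrete. The topology on
  \<open>'a \<Rightarrow> bool\<close> is the library's product topology, i.e. pointwise convergence, and the notion
  \<open>discrete\<close> used below refers to subspaces of it; this is also the relative topology inherited
  through \<open>C\<^sub>p(K,2)\<close>.
\<close>

definition Cp2 :: "('a::topological_space \<Rightarrow> bool) set"
  where "Cp2 = {f. continuous_on UNIV f}"

definition sigma_discrete :: "'a::topological_space set \<Rightarrow> bool"
  where "sigma_discrete S \<longleftrightarrow>
    (\<exists>\<D>. countable \<D> \<and> (\<forall>D\<in>\<D>. discrete D) \<and> \<Union>\<D> = S)"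

end

theory Submission
  imports Defs
begin

text \<open>
  Call \<open>p\<close> \<^emph>\<open>open\<close> when its principal filter \<open>{p..}\<close> is open; it is then clopen.

  Open elements are compact (\<open>compact_element_if_open_atLeast\<close>), so modesty makes their sets of
  immediate predecessors finite, and everything strictly below an open element lies below one of
  these predecessors (\<open>le_immediate_predecessor\<close>).  Conversely there are many open elements: in
  a compact totally disconnected semilattice their filters separate the points
  (\<open>separating_open_atLeast\<close>, a theorem of Numakura).  Two such filters are either disjoint or
  meet in a third one, so their sums modulo 2 form a Boolean algebra of clopen sets, and by
  compactness every clopen set is such a sum (\<open>clopen_imp_filter_sum\<close>).

  Hence every \<open>f\<close> in \<open>C\<^sub>p(K,2)\<close> is the sum modulo 2 of the characteristic functions of \<open>{p..}\<close>
  for \<open>p\<close> in a finite set \<open>F\<close> of open elements, and it suffices to see that for each \<open>n\<close> the sums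
  with \<open>card F = n\<close> form a discrete set.  Let \<open>M\<close> be a finite set closed under meets that contains
  \<open>F\<close> and all immediate predecessors of its elements.  If the sum over some \<open>G\<close> with \<open>n\<close>
  elements agrees on \<open>M\<close> with the sum over \<open>F\<close>, send every \<open>q\<close> in \<open>G\<close> to the least element of
  \<open>M\<close> above it; those \<open>q\<close> that are below no element of \<open>M\<close> contribute nothing on \<open>M\<close>.  On \<open>M\<close>
  the filter of \<open>q\<close> equals the filter of its image, and the principal filters of a finite ordered set
  are linearly independent modulo 2.  So every \<open>m\<close> in \<open>F\<close> is the image of some \<open>q\<close>.  This \<open>q\<close> lies below \<open>m\<close> but below none of the predecessors of \<open>m\<close>, whence \<open>q = m\<close>.
  Therefore \<open>F \<subseteq> G\<close>, and \<open>F = G\<close> because the cardinalities agree.  In other words, the values on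
  the finite set \<open>M\<close> already isolate the sum over \<open>F\<close>.
\<close>

section \<open>Principal filters and ideals in a compact semilattice\<close>

lemma continuous_on_inf_compact_semilattice:
  fixes f g :: "'b::topological_space \<Rightarrow> 'a::{semilattice_inf, order_bot, t2_space}"
  assumes "compact_semilattice TYPE('a)" "continuous_on S f" "continuous_on S g"
  shows "continuous_on S (\<lambda>x. inf (f x) (g x))"
proof -
  have "continuous_on UNIV (\<lambda>(x::'a, y). inf x y)"
    using assms(1) by (simp add: compact_semilattice_def)
  from continuous_on_compose2[OF this continuous_on_Pair[OF assms(2,3)]] show ?thesis
    by simp
qed

lemma compact_if_closed:
  fixes S :: "'a::{semilattice_inf, order_bot, t2_space} set"
  assumes "compact_semilattice TYPE('a)" "closed S"
  shows "compact S"
  using assms compact_Int_closed[of UNIV S] by (simp add: compact_semilattice_def)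

lemma closed_atLeast_compact_semilattice:
  fixes p :: "'a::{semilattice_inf, order_bot, t2_space}"
  assumes "compact_semilattice TYPE('a)"
  shows "closed {p..}"
proof -
  have "{p..} = {x. inf p x = p}"
    by (auto simp: inf_absorb1) (metis inf_le2)
  moreover have "closed {x. inf p x = p}"
    by (intro closed_Collect_eq continuous_on_inf_compact_semilattice assms continuous_intros)
  ultimately show ?thesis by simp
qed

lemma closed_atMost_compact_semilattice:
  fixes p :: "'a::{semilattice_inf, order_bot, t2_space}"
  assumes "compact_semilattice TYPE('a)"
  shows "closed {..p}"
proof -
  have "{..p} = {x. inf x p = x}"
    by (auto simp: inf_absorb1) (metis inf_le2)
  moreover have "closed {x. inf x p = x}"
    by (intro closed_Collect_eq continuous_on_inf_compact_semilattice assms continuous_intros)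
  ultimately show ?thesis by simp
qed

lemma closed_inf_closed_has_least:
  fixes T :: "'a::{semilattice_inf, order_bot, t2_space} set"
  assumes K: "compact_semilattice TYPE('a)" and T: "closed T" "T \<noteq> {}"
    and inf: "\<And>x y. x \<in> T \<Longrightarrow> y \<in> T \<Longrightarrow> inf x y \<in> T"
  obtains p where "p \<in> T" "\<And>t. t \<in> T \<Longrightarrow> p \<le> t"
proof -
  have fin: "\<exists>t\<in>T. \<forall>i\<in>I. t \<le> i" if "finite I" "I \<subseteq> T" for I
    using that
  proof (induction I rule: finite_induct)
    case empty
    then show ?case using T by auto
  next
    case (insert i I)
    then obtain t where "t \<in> T" "\<forall>i\<in>I. t \<le> i" by auto
    then have "inf i t \<in> T" "\<forall>j\<in>insert i I. inf i t \<le> j"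
      using insert.prems inf by (auto intro: le_infI2)
    then show ?case by blast
  qed
  have "T \<inter> (\<Inter>t\<in>T. {..t}) \<noteq> {}"
  proof (rule compact_imp_fip_image)
    show "compact T" using K T(1) by (rule compact_if_closed)
    show "closed {..t}" for t :: 'a by (rule closed_atMost_compact_semilattice[OF K])
    show "T \<inter> (\<Inter>t\<in>I. {..t}) \<noteq> {}" if "finite I" "I \<subseteq> T" for I
      using fin[OF that] by blast
  qed
  then show thesis using that by auto
qed

section \<open>Open elements and their immediate predecessors\<close>

text \<open>
  The elements strictly below an open \<open>p\<close> form the compact set \<open>{..p} - {p..}\<close>, so the finite
  intersection property applies to the upper bounds of \<open>A\<close> in it.
\<close>

lemma strict_upper_bound_if_finitely:
  fixes p :: "'a::{semilattice_inf, order_bot, t2_space}"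
  assumes K: "compact_semilattice TYPE('a)" and p: "open {p..}"
    and fin: "\<And>B. finite B \<Longrightarrow> B \<subseteq> A \<Longrightarrow> \<exists>u<p. \<forall>b\<in>B. b \<le> u"
  shows "\<exists>u<p. \<forall>a\<in>A. a \<le> u"
proof -
  have eq: "{..p} - {p..} = {..<p}"
    by auto
  have "({..p} - {p..}) \<inter> (\<Inter>a\<in>A. {a..}) \<noteq> {}"
  proof (rule compact_imp_fip_image)
    show "compact ({..p} - {p..})"
      using p by (intro compact_if_closed K closed_Diff closed_atMost_compact_semilattice)
    show "closed {a..}" for a :: 'a by (rule closed_atLeast_compact_semilattice[OF K])
    show "({..p} - {p..}) \<inter> (\<Inter>a\<in>B. {a..}) \<noteq> {}" if "finite B" "B \<subseteq> A" for B
      using fin[OF that] unfolding eq by auto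
  qed
  then show ?thesis unfolding eq by auto
qed

text \<open>
  If a set \<open>B\<close> bounded by \<open>p\<close> has no upper bound strictly below \<open>p\<close>, then \<open>p\<close> is its supremum,
  since \<open>inf v p\<close> is an upper bound of \<open>B\<close> for every upper bound \<open>v\<close>.  So if no finite subset
  of \<open>A\<close> had supremum \<open>p\<close>, compactness would give an upper bound of \<open>A\<close> strictly below \<open>p\<close>.
\<close>

lemma compact_element_if_open_atLeast:
  fixes p :: "'a::{semilattice_inf, order_bot, t2_space}"
  assumes K: "compact_semilattice TYPE('a)" and p: "open {p..}"
  shows "compact_element p"
  unfolding compact_element_def
proof (intro allI impI, rule ccontr)
  fix A assume A: "isLub UNIV A p" and no: "\<not> (\<exists>B\<subseteq>A. finite B \<and> isLub UNIV B p)"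
  have "\<exists>u<p. \<forall>b\<in>B. b \<le> u" if B: "finite B" "B \<subseteq> A" for B
  proof (rule ccontr)
    assume none: "\<not> ?thesis"
    have ub: "b \<le> p" if "b \<in> B" for b
      using isLubD2[OF A] that B by blast
    have "p \<le> v" if v: "\<forall>b\<in>B. b \<le> v" for v
    proof -
      have "\<forall>b\<in>B. b \<le> inf v p" using v ub by simp
      then have "\<not> inf v p < p" using none by blast
      then have "inf v p = p" using inf_le2[of v p] by (simp add: less_le)
      then show ?thesis by (metis inf_le1)
    qed
    then have "isLub UNIV B p"
      using ub by (auto simp: isLub_def leastP_def isUb_def setle_def setge_def)
    with no B show False by blast
  qed
  from strict_upper_bound_if_finitely[OF K p this]
  obtain u where "u < p" "\<forall>a\<in>A. a \<le> u" by blast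
  then have "p \<le> u" using A by (auto simp: isLub_def leastP_def isUb_def setle_def setge_def)
  with \<open>u < p\<close> show False by simp
qed

text \<open>
  A chain strictly below \<open>p\<close> is bounded strictly below \<open>p\<close>, because each of its finite subsets has
  a maximum; Zorn's lemma then yields a maximal element above \<open>q\<close> and strictly below \<open>p\<close>.
\<close>

lemma le_immediate_predecessor:
  fixes p q :: "'a::{semilattice_inf, order_bot, t2_space}"
  assumes K: "compact_semilattice TYPE('a)" and p: "open {p..}" and q: "q < p"
  obtains x where "x \<in> immediate_predecessors p" "q \<le> x"
proof -
  define A where "A = {y. q \<le> y \<and> y < p}"
  have "\<exists>m\<in>A. \<forall>a\<in>A. m \<le> a \<longrightarrow> a = m"
  proof (rule predicate_Zorn)
    show "partial_order_on A (relation_of (\<le>) A)"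
      by (rule partial_order_on_relation_ofI) auto
    fix C assume C: "C \<in> Chains (relation_of (\<le>) A)"
    then have sub: "C \<subseteq> A" by (rule Chains_relation_of)
    have chain: "a \<le> b \<or> b \<le> a" if "a \<in> C" "b \<in> C" for a b
      using C that by (auto simp: Chains_def relation_of_def)
    have "\<exists>u<p. \<forall>b\<in>insert q C. b \<le> u"
    proof (rule strict_upper_bound_if_finitely[OF K p])
      fix B assume B: "finite B" "B \<subseteq> insert q C"
      have "\<exists>u\<in>insert q C. \<forall>b\<in>B. b \<le> u"
        using B
      proof (induction B rule: finite_induct)
        case empty
        then show ?case by auto
      next
        case (insert b B)
        then obtain u where u: "u \<in> insert q C" "\<forall>b\<in>B. b \<le> u" by auto
        have "b \<le> u \<or> u \<le> b"
          using insert.prems u(1) sub chain unfolding A_def by blast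
        moreover have ?case if "u \<le> b"
        proof (intro bexI ballI)
          show "c \<le> b" if "c \<in> insert b B" for c
            using that u(2) order_trans[OF _ \<open>u \<le> b\<close>] by auto
          show "b \<in> insert q C" using insert.prems by simp
        qed
        ultimately show ?case using u by blast
      qed
      then show "\<exists>u<p. \<forall>b\<in>B. b \<le> u" using q sub unfolding A_def by blast
    qed
    then show "\<exists>u\<in>A. \<forall>a\<in>C. a \<le> u" unfolding A_def by blast
  qed
  then obtain m where m: "q \<le> m" "m < p" "\<And>a. q \<le> a \<Longrightarrow> a < p \<Longrightarrow> m \<le> a \<Longrightarrow> a = m"
    unfolding A_def by blast
  have "m \<in> immediate_predecessors p"
    unfolding immediate_predecessors_def
    using m(2) m(3) order_trans[OF m(1)] by (auto simp: less_le)
  with m(1) that show thesis by blast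
qed

section \<open>Filters of open elements separate the points\<close>

text \<open>
  In a compact Hausdorff space components and quasi-components coincide, so totally disconnected
  means that any two points are separated by a clopen set.
\<close>

lemma totally_disconnected_imp_clopen_separation:
  fixes x y :: "'a::t2_space"
  assumes K: "compact (UNIV :: 'a set)" and td: "totally_disconnected (UNIV :: 'a set)"
    and ne: "x \<noteq> y"
  obtains V where "open V" "closed V" "x \<in> V" "y \<notin> V"
proof -
  have "compact_space (euclidean :: 'a topology)"
    using K by (simp add: compact_space_def)
  moreover have "Hausdorff_space (euclidean :: 'a topology)"
    unfolding Hausdorff_space_def disjnt_def by (metis hausdorff open_openin)
  ultimately have eq: "quasi_component_of (euclidean :: 'a topology) x = connected_component_of euclidean x"
    by (intro quasi_eq_connected_component_of) simp
  have "\<not> connected_component_of euclidean x y"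
  proof
    assume "connected_component_of euclidean x y"
    then obtain C where C: "connected C" "x \<in> C" "y \<in> C"
      by (auto simp: connected_component_of_def)
    then obtain c where "C \<subseteq> {c}" using td unfolding totally_disconnected_def by blast
    then show False using C(2,3) ne by blast
  qed
  then have "\<not> quasi_component_of euclidean x y" by (simp add: eq)
  then obtain T where T: "closed T" "open T" "x \<in> T \<longleftrightarrow> y \<notin> T"
    by (auto simp: quasi_component_of_def)
  show thesis
  proof (cases "x \<in> T")
    case True
    then show thesis using T that[of T] by auto
  next
    case False
    then show thesis using T that[of "- T"] by (auto simp: open_Compl closed_Compl)
  qed
qed

text \<open>
  The members of \<open>\<B>\<close> that contain \<open>x\<close> have no common point in \<open>C\<close>, so by compactness finitely
  many of them have none; their intersection is the required set.  The lemma is used once for all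
  clopen sets and once for the sums of filters.
\<close>

lemma separate_point_from_compact:
  fixes C :: "'a::topological_space set"
  assumes C: "compact C" and univ: "UNIV \<in> \<B>"
    and int: "\<And>A B. A \<in> \<B> \<Longrightarrow> B \<in> \<B> \<Longrightarrow> A \<inter> B \<in> \<B>"
    and clo: "\<And>B. B \<in> \<B> \<Longrightarrow> closed B"
    and sep: "\<And>y. y \<in> C \<Longrightarrow> \<exists>B\<in>\<B>. x \<in> B \<and> y \<notin> B"
  obtains B where "B \<in> \<B>" "x \<in> B" "B \<inter> C = {}"
proof -
  define \<B>x where "\<B>x = {B\<in>\<B>. x \<in> B}"
  have fin: "\<Inter>F \<in> \<B>x" if "finite F" "F \<subseteq> \<B>x" for F
    using that by (induction F rule: finite_induct) (auto simp: \<B>x_def univ int)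
  have "y \<notin> \<Inter>\<B>x" if "y \<in> C" for y using sep[OF that] unfolding \<B>x_def by blast
  then have "C \<inter> \<Inter>\<B>x = {}" by blast
  then obtain F where F: "finite F" "F \<subseteq> \<B>x" "C \<inter> \<Inter>F = {}"
    using compact_imp_fip[OF C, of \<B>x] clo unfolding \<B>x_def by blast
  with fin[OF F(1,2)] show thesis using that[of "\<Inter>F"] unfolding \<B>x_def by auto
qed

text \<open>
  The tube lemma: in a compact space, a condition that is open in \<open>(z, v)\<close> and is imposed for all
  \<open>v\<close> in a closed set is open in \<open>z\<close>.
\<close>

lemma open_stabilizer:
  fixes V :: "'a::{semilattice_inf, order_bot, t2_space} set"
  assumes K: "compact_semilattice TYPE('a)" and V: "open V" "closed V"
  shows "open {z. \<forall>v\<in>V. inf z v \<in> V}"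
proof -
  define S where "S = UNIV \<times> V \<inter> (\<lambda>z. inf (fst z) (snd z)) -` (- V)"
  have "closed S" unfolding S_def
    by (intro closed_Int closed_Times closed_UNIV V closed_vimage
        continuous_on_inf_compact_semilattice[OF K] continuous_intros closed_Compl)
  moreover have "compact_space (euclidean :: 'a topology)"
    using K by (simp add: compact_space_def compact_semilattice_def)
  then have "closed_map (prod_topology (euclidean :: 'a topology) (euclidean :: 'a topology)) euclidean fst"
    by (rule closed_map_fst)
  ultimately have "closed (fst ` S)"
    unfolding closed_map_def by simp
  moreover have "{z. \<forall>v\<in>V. inf z v \<in> V} = - (fst ` S)"
    by (force simp: S_def image_iff)
  ultimately show ?thesis by (simp add: open_Compl)
qed

text \<open>
  Numakura's argument.  Choose a clopen \<open>V\<close> containing \<open>x\<close> and missing everything below \<open>y\<close>.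
  The clopen set \<open>V' = {z. inf x z \<in> V}\<close> contains \<open>x\<close> and is moreover mapped to itself by \<open>inf x\<close>,
  so \<open>x\<close> belongs to the clopen subsemilattice \<open>T\<close> of those \<open>z \<in> V'\<close> for which \<open>inf z\<close> maps \<open>V'\<close>
  to itself.  The least element \<open>p\<close> of \<open>T\<close> is open because \<open>{p..}\<close> is the preimage of \<open>T\<close>
  under \<open>inf p\<close>.
\<close>

lemma separating_open_atLeast:
  fixes x y :: "'a::{semilattice_inf, order_bot, t2_space}"
  assumes K: "compact_semilattice TYPE('a)" and td: "totally_disconnected (UNIV :: 'a set)"
    and ne: "\<not> x \<le> y"
  obtains p where "open {p..}" "p \<le> x" "\<not> p \<le> y"
proof -
  have cpt: "compact (UNIV :: 'a set)" using K by (simp add: compact_semilattice_def)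
  obtain V where V: "V \<in> {V. open V \<and> closed V}" "x \<in> V" "V \<inter> {..y} = {}"
  proof (rule separate_point_from_compact)
    show "compact {..y}"
      by (intro compact_if_closed K closed_atMost_compact_semilattice)
    show "\<exists>B\<in>{V. open V \<and> closed V}. x \<in> B \<and> z \<notin> B" if "z \<in> {..y}" for z
    proof -
      have "x \<noteq> z" using that ne by auto
      from totally_disconnected_imp_clopen_separation[OF cpt td this] show ?thesis by blast
    qed
  qed auto
  define V' where "V' = {z. inf x z \<in> V}"
  have cont: "continuous_on UNIV (\<lambda>z. inf w z)" for w :: 'a
    by (intro continuous_on_inf_compact_semilattice K continuous_intros)
  have vimage: "open {z. inf w z \<in> W}" "closed {z. inf w z \<in> W}" if "open W" "closed W" for W and w :: 'a
    using open_vimage[OF that(1) cont] closed_vimage[OF that(2) cont] by (auto simp: vimage_def)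
  have V': "open V'" "closed V'" using V(1) vimage by (auto simp: V'_def)
  define T where "T = V' \<inter> {z. \<forall>v\<in>V'. inf z v \<in> V'}"
  have T: "open T" "closed T"
  proof -
    show "open T" unfolding T_def by (intro open_Int V' open_stabilizer K)
    have "{z. \<forall>v\<in>V'. inf z v \<in> V'} = (\<Inter>v\<in>V'. {z. inf v z \<in> V'})"
      by (auto simp: inf_commute)
    also have "closed \<dots>" using vimage(2)[OF V'] by blast
    finally show "closed T" unfolding T_def by (intro closed_Int V')
  qed
  have xT: "x \<in> T" using V(2) by (simp add: T_def V'_def)
  have infT: "inf z w \<in> T" if "z \<in> T" "w \<in> T" for z w
    using that by (auto simp: T_def inf_assoc)
  obtain p where p: "p \<in> T" "\<And>t. t \<in> T \<Longrightarrow> p \<le> t"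
    using closed_inf_closed_has_least[OF K T(2) _ infT] xT by blast
  have "{p..} = {z. inf p z \<in> T}"
  proof (intro set_eqI iffI)
    fix z assume "z \<in> {p..}"
    then show "z \<in> {z. inf p z \<in> T}" using p(1) by (simp add: inf_absorb1)
  next
    fix z assume "z \<in> {z. inf p z \<in> T}"
    then have "p \<le> inf p z" by (intro p(2)) simp
    then show "z \<in> {p..}" by simp
  qed
  then have op: "open {p..}" using vimage(1)[OF T] by simp
  have px: "p \<le> x" using p(2) xT by simp
  have "inf x p \<in> V" using p(1) by (simp add: T_def V'_def)
  then have "p \<in> V" using px by (simp add: inf_absorb2)
  then have "\<not> p \<le> y" using V(3) by auto
  with op px that show thesis by blast
qed

section \<open>Clopen sets as sums of filters modulo 2\<close>

definition filter_sum :: "'a::order set \<Rightarrow> 'a set"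
  where "filter_sum F = {x. odd (card {p\<in>F. p \<le> x})}"

lemma filter_sum_insert:
  assumes "finite F" "p \<notin> F"
  shows "filter_sum (insert p F) = sym_diff {p..} (filter_sum F)"
proof (rule set_eqI)
  fix x
  show "x \<in> filter_sum (insert p F) \<longleftrightarrow> x \<in> sym_diff {p..} (filter_sum F)"
  proof (cases "p \<le> x")
    case True
    then have "{q \<in> insert p F. q \<le> x} = insert p {q\<in>F. q \<le> x}" by blast
    then have "card {q \<in> insert p F. q \<le> x} = Suc (card {q\<in>F. q \<le> x})" using assms by simp
    then show ?thesis using True by (simp add: filter_sum_def)
  next
    case False
    then have "{q \<in> insert p F. q \<le> x} = {q\<in>F. q \<le> x}" by blast
    then show ?thesis using False by (simp add: filter_sum_def)
  qed
qed

definition filter_sums :: "'a::{order, topological_space} set set"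
  where "filter_sums = {filter_sum F |F. finite F \<and> (\<forall>p\<in>F. open {p..})}"

lemma empty_in_filter_sums: "{} \<in> filter_sums"
proof -
  have "{} = filter_sum {}" by (simp add: filter_sum_def)
  then show ?thesis unfolding filter_sums_def by blast
qed

lemma sym_diff_atLeast_in_filter_sums:
  assumes "open {p..}" "A \<in> filter_sums"
  shows "sym_diff {p..} A \<in> filter_sums"
proof -
  obtain F where F: "A = filter_sum F" "finite F" "\<forall>p\<in>F. open {p..}"
    using assms(2) by (auto simp: filter_sums_def)
  show ?thesis
  proof (cases "p \<in> F")
    case True
    then have "filter_sum F = sym_diff {p..} (filter_sum (F - {p}))"
      using filter_sum_insert[of "F - {p}" p] F(2) by (simp add: insert_absorb)
    then have "sym_diff {p..} A = filter_sum (F - {p})" using F(1) by blast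
    then show ?thesis using F unfolding filter_sums_def by blast
  next
    case False
    then have "sym_diff {p..} A = filter_sum (insert p F)"
      using filter_sum_insert[of F p] F by simp
    moreover have "finite (insert p F)" "\<forall>q\<in>insert p F. open {q..}" using F assms(1) by auto
    ultimately show ?thesis unfolding filter_sums_def by blast
  qed
qed

lemma filter_sums_induct [consumes 1, case_names empty sym_diff]:
  assumes "A \<in> filter_sums" "P {}"
    and step: "\<And>p A. open {p..} \<Longrightarrow> A \<in> filter_sums \<Longrightarrow> P A \<Longrightarrow> P (sym_diff {p..} A)"
  shows "P A"
proof -
  obtain F where F: "A = filter_sum F" "finite F" "\<forall>p\<in>F. open {p..}"
    using assms(1) by (auto simp: filter_sums_def)
  have "P (filter_sum F)"
    using F(2,3)
  proof (induction F rule: finite_induct)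
    case empty
    then show ?case using assms(2) by (simp add: filter_sum_def)
  next
    case (insert p F)
    then have "filter_sum F \<in> filter_sums" by (auto simp: filter_sums_def)
    with insert show ?case by (simp add: filter_sum_insert step)
  qed
  then show ?thesis using F(1) by simp
qed

lemma atLeast_in_filter_sums: "open {p..} \<Longrightarrow> {p..} \<in> filter_sums"
  using sym_diff_atLeast_in_filter_sums[OF _ empty_in_filter_sums, of p] by simp

lemma sym_diff_in_filter_sums:
  assumes "A \<in> filter_sums" "B \<in> filter_sums"
  shows "sym_diff A B \<in> filter_sums"
  using assms(1)
proof (induction A rule: filter_sums_induct)
  case empty
  then show ?case using assms(2) by simp
next
  case (sym_diff p A)
  have "sym_diff (sym_diff {p..} A) B = sym_diff {p..} (sym_diff A B)" by blast
  with sym_diff_atLeast_in_filter_sums[OF sym_diff(1,3)] show ?case by simp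
qed

lemma filter_sums_clopen:
  fixes A :: "'a::{semilattice_inf, order_bot, t2_space} set"
  assumes K: "compact_semilattice TYPE('a)" and A: "A \<in> filter_sums"
  shows "open A \<and> closed A"
  using A
proof (induction A rule: filter_sums_induct)
  case (sym_diff p A)
  then show ?case
    using closed_atLeast_compact_semilattice[OF K, of p] by (auto intro: open_Diff closed_Diff)
qed auto

text \<open>
  A nonempty intersection of two open filters is a compact subsemilattice, and its least element
  (the supremum of the two generators) generates it.
\<close>

lemma atLeast_Int_atLeast_in_filter_sums:
  fixes p q :: "'a::{semilattice_inf, order_bot, t2_space}"
  assumes K: "compact_semilattice TYPE('a)" and "open {p..}" "open {q..}"
  shows "{p..} \<inter> {q..} \<in> filter_sums"
proof (cases "{p..} \<inter> {q..} = {}")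
  case True
  then show ?thesis by (simp add: empty_in_filter_sums)
next
  case False
  have "closed ({p..} \<inter> {q..})"
    by (intro closed_Int closed_atLeast_compact_semilattice K)
  then obtain r where r: "r \<in> {p..} \<inter> {q..}" "\<And>t. t \<in> {p..} \<inter> {q..} \<Longrightarrow> r \<le> t"
    using closed_inf_closed_has_least[OF K _ False] by auto
  then have "{p..} \<inter> {q..} = {r..}"
    by (auto intro: order_trans)
  then show ?thesis using open_Int[OF assms(2,3)] atLeast_in_filter_sums by metis
qed

lemma Int_in_filter_sums:
  fixes A B :: "'a::{semilattice_inf, order_bot, t2_space} set"
  assumes K: "compact_semilattice TYPE('a)" and A: "A \<in> filter_sums" and B: "B \<in> filter_sums"
  shows "A \<inter> B \<in> filter_sums"
proof -
  have one: "{p..} \<inter> B \<in> filter_sums" if p: "open {p..}" for p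
    using B
  proof (induction B rule: filter_sums_induct)
    case (sym_diff q B)
    have "{p..} \<inter> sym_diff {q..} B = sym_diff ({p..} \<inter> {q..}) ({p..} \<inter> B)" by blast
    with sym_diff show ?case
      using atLeast_Int_atLeast_in_filter_sums[OF K p] sym_diff_in_filter_sums by metis
  qed (simp add: empty_in_filter_sums)
  show ?thesis
    using A
  proof (induction A rule: filter_sums_induct)
    case (sym_diff p A)
    have "sym_diff {p..} A \<inter> B = sym_diff ({p..} \<inter> B) (A \<inter> B)" by blast
    with sym_diff show ?case using one sym_diff_in_filter_sums by metis
  qed (simp add: empty_in_filter_sums)
qed

lemma UNIV_in_filter_sums: "(UNIV :: 'a::{order_bot, topological_space} set) \<in> filter_sums"
proof -
  have "{bot..} = (UNIV :: 'a set)" by auto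
  then show ?thesis using atLeast_in_filter_sums[of "bot :: 'a"] by simp
qed

lemma Compl_in_filter_sums:
  fixes A :: "'a::{order_bot, topological_space} set"
  assumes "A \<in> filter_sums"
  shows "- A \<in> filter_sums"
proof -
  have "- A = sym_diff UNIV A" by blast
  then show ?thesis using sym_diff_in_filter_sums[OF UNIV_in_filter_sums assms] by simp
qed

lemma Un_in_filter_sums:
  fixes A B :: "'a::{semilattice_inf, order_bot, t2_space} set"
  assumes K: "compact_semilattice TYPE('a)" and A: "A \<in> filter_sums" and B: "B \<in> filter_sums"
  shows "A \<union> B \<in> filter_sums"
proof -
  have "A \<union> B = - (- A \<inter> - B)" by blast
  then show ?thesis using Int_in_filter_sums[OF K] Compl_in_filter_sums A B by metis
qed

text \<open>
  A Boolean algebra of clopen sets that separates the points of a compact space contains all clopen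
  sets: each point of \<open>U\<close> is separated from the complement of \<open>U\<close> by a member, and finitely many
  of these members cover \<open>U\<close>.
\<close>

lemma clopen_imp_filter_sum:
  fixes U :: "'a::{semilattice_inf, order_bot, t2_space} set"
  assumes K: "compact_semilattice TYPE('a)" and td: "totally_disconnected (UNIV :: 'a set)"
    and U: "open U" "closed U"
  shows "U \<in> filter_sums"
proof -
  have sep: "\<exists>B\<in>filter_sums. x \<in> B \<and> y \<notin> B" if "x \<noteq> y" for x y :: 'a
  proof (cases "x \<le> y")
    case False
    from separating_open_atLeast[OF K td this] obtain p where "open {p..}" "p \<le> x" "\<not> p \<le> y" .
    then show ?thesis using atLeast_in_filter_sums by (intro bexI[of _ "{p..}"]) auto
  next
    case True
    then have "\<not> y \<le> x" using that by auto
    from separating_open_atLeast[OF K td this] obtain p where "open {p..}" "p \<le> y" "\<not> p \<le> x" .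
    then show ?thesis
      using atLeast_in_filter_sums Compl_in_filter_sums by (intro bexI[of _ "- {p..}"]) auto
  qed
  have nbhd: "\<exists>B\<in>filter_sums. x \<in> B \<and> B \<subseteq> U" if x: "x \<in> U" for x
  proof -
    obtain B where "B \<in> filter_sums" "x \<in> B" "B \<inter> - U = {}"
    proof (rule separate_point_from_compact)
      show "compact (- U)" using U(1) by (intro compact_if_closed K) auto
      show "\<exists>B\<in>filter_sums. x \<in> B \<and> y \<notin> B" if "y \<in> - U" for y
        using sep[of x y] x that by auto
    qed (use filter_sums_clopen[OF K] Int_in_filter_sums[OF K] UNIV_in_filter_sums in auto)
    then show ?thesis by blast
  qed
  define \<B> where "\<B> = {B\<in>filter_sums. B \<subseteq> U}"
  have "compact U" using K U(2) by (rule compact_if_closed)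
  moreover have "\<forall>B\<in>\<B>. open B" using filter_sums_clopen[OF K] by (auto simp: \<B>_def)
  moreover have "U \<subseteq> \<Union>\<B>" using nbhd by (auto simp: \<B>_def)
  ultimately obtain \<F> where \<F>: "\<F> \<subseteq> \<B>" "finite \<F>" "U \<subseteq> \<Union>\<F>"
    by (metis compactE)
  have "\<Union>\<F> \<in> filter_sums"
    using \<F>(2,1) by (induction \<F> rule: finite_induct)
      (auto simp: \<B>_def empty_in_filter_sums Un_in_filter_sums[OF K])
  moreover have "\<Union>\<F> = U" using \<F> by (auto simp: \<B>_def)
  ultimately show ?thesis by simp
qed

section \<open>Finitely many values isolate a filter sum among those of the same size\<close>

lemma finite_inf_closure:
  fixes A :: "'a::semilattice_inf set"
  assumes "finite A"
  obtains M where "finite M" "A \<subseteq> M" "\<And>x y. x \<in> M \<Longrightarrow> y \<in> M \<Longrightarrow> inf x y \<in> M"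
proof
  let ?M = "Inf_fin ` {B. B \<subseteq> A \<and> B \<noteq> {}}"
  show "finite ?M" using assms by simp
  show "A \<subseteq> ?M"
  proof
    fix a assume "a \<in> A"
    then show "a \<in> ?M" by (intro image_eqI[of _ _ "{a}"]) auto
  qed
  fix x y assume "x \<in> ?M" "y \<in> ?M"
  then obtain B C where "B \<subseteq> A" "B \<noteq> {}" "x = Inf_fin B" "C \<subseteq> A" "C \<noteq> {}" "y = Inf_fin C"
    by auto
  then have "inf x y = Inf_fin (B \<union> C)"
    using Inf_fin.union[OF finite_subset[OF _ assms] _ finite_subset[OF _ assms], of B C] by metis
  moreover have "B \<union> C \<in> {B. B \<subseteq> A \<and> B \<noteq> {}}"
    using \<open>B \<subseteq> A\<close> \<open>B \<noteq> {}\<close> \<open>C \<subseteq> A\<close> by blast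
  ultimately show "inf x y \<in> ?M" by (rule image_eqI)
qed

text \<open>For \<open>m \<in> M\<close> the last two conditions say that \<open>m\<close> is the least element of \<open>M\<close> above \<open>q\<close>.\<close>

definition approx_fibre :: "'a::order set \<Rightarrow> 'a set \<Rightarrow> 'a \<Rightarrow> 'a set"
  where "approx_fibre M G m = {q\<in>G. q \<le> m \<and> (\<forall>m'\<in>M. q \<le> m' \<longrightarrow> m \<le> m')}"

text \<open>
  Since \<open>M\<close> is closed under meets, every \<open>q\<close> below some \<open>m \<in> M\<close> has a least upper approximation in
  \<open>M\<close>; so \<open>{q\<in>G. q \<le> m}\<close> is partitioned into the fibres over the elements of \<open>M\<close> below \<open>m\<close>.
\<close>

lemma card_le_eq_sum_approx_fibre:
  fixes M :: "'a::semilattice_inf set"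
  assumes M: "finite M" and inf: "\<And>x y. x \<in> M \<Longrightarrow> y \<in> M \<Longrightarrow> inf x y \<in> M"
    and G: "finite G" and m: "m \<in> M"
  shows "card {q\<in>G. q \<le> m} = (\<Sum>m'\<in>{m'\<in>M. m' \<le> m}. card (approx_fibre M G m'))"
proof -
  have least: "\<exists>m'\<in>M. q \<le> m' \<and> m' \<le> m \<and> (\<forall>m''\<in>M. q \<le> m'' \<longrightarrow> m' \<le> m'')" if q: "q \<le> m" for q
  proof -
    have fin: "finite {m'\<in>M. q \<le> m'}" and "{m'\<in>M. q \<le> m'} \<noteq> {}" using M m q by auto
    then obtain l where l: "l \<in> M" "q \<le> l"
      and min: "\<And>k. k \<in> M \<Longrightarrow> q \<le> k \<Longrightarrow> k \<le> l \<Longrightarrow> k = l"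
      using finite_has_minimal[of "{m'\<in>M. q \<le> m'}"] by auto
    have "l \<le> k" if "k \<in> M" "q \<le> k" for k
      using min[of "inf l k"] inf l that by (metis inf_le1 inf_le2 le_inf_iff)
    then show ?thesis using l m q by blast
  qed
  have "{q\<in>G. q \<le> m} = (\<Union>m'\<in>{m'\<in>M. m' \<le> m}. approx_fibre M G m')"
  proof (intro set_eqI iffI)
    fix q assume "q \<in> {q\<in>G. q \<le> m}"
    then show "q \<in> (\<Union>m'\<in>{m'\<in>M. m' \<le> m}. approx_fibre M G m')"
      using least[of q] by (auto simp: approx_fibre_def)
  next
    fix q assume "q \<in> (\<Union>m'\<in>{m'\<in>M. m' \<le> m}. approx_fibre M G m')"
    then show "q \<in> {q\<in>G. q \<le> m}"
      by (auto simp: approx_fibre_def intro: order_trans)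
  qed
  also have "card \<dots> = (\<Sum>m'\<in>{m'\<in>M. m' \<le> m}. card (approx_fibre M G m'))"
  proof (rule card_UN_disjoint)
    show "\<forall>i\<in>{m'\<in>M. m' \<le> m}. \<forall>j\<in>{m'\<in>M. m' \<le> m}. i \<noteq> j \<longrightarrow> approx_fibre M G i \<inter> approx_fibre M G j = {}"
      by (auto simp: approx_fibre_def intro: order_antisym)
  qed (use M G in \<open>auto simp: approx_fibre_def\<close>)
  finally show ?thesis .
qed

text \<open>
  This is the linear independence modulo 2 of the principal filters of the finite ordered set \<open>M\<close>:
  evaluating both sums at \<open>m\<close> and cancelling the fibres over smaller elements leaves the fibre
  over \<open>m\<close>.
\<close>

lemma odd_card_approx_fibre_eq:
  fixes M :: "'a::semilattice_inf set"
  assumes M: "finite M" and inf: "\<And>x y. x \<in> M \<Longrightarrow> y \<in> M \<Longrightarrow> inf x y \<in> M"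
    and F: "finite F" and G: "finite G"
    and agree: "\<And>m. m \<in> M \<Longrightarrow> m \<in> filter_sum G \<longleftrightarrow> m \<in> filter_sum F" and "m \<in> M"
  shows "odd (card (approx_fibre M G m)) \<longleftrightarrow> odd (card (approx_fibre M F m))"
  using M \<open>m \<in> M\<close>
proof (induction "card {m'\<in>M. m' < m}" arbitrary: m rule: less_induct)
  case less
  have split: "card {q\<in>H. q \<le> m}
      = card (approx_fibre M H m) + (\<Sum>m'\<in>{m'\<in>M. m' < m}. card (approx_fibre M H m'))"
    if "finite H" for H
  proof -
    have "{m'\<in>M. m' \<le> m} = insert m {m'\<in>M. m' < m}" using less.prems by auto
    then show ?thesis using card_le_eq_sum_approx_fibre[OF M inf that \<open>m \<in> M\<close>] M by simp
  qed
  have below: "odd (card (approx_fibre M G m')) \<longleftrightarrow> odd (card (approx_fibre M F m'))"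
    if "m' \<in> {m'\<in>M. m' < m}" for m'
  proof (rule less.hyps)
    have "{k\<in>M. k < m'} \<subset> {k\<in>M. k < m}" using that by auto
    then show "card {k\<in>M. k < m'} < card {k\<in>M. k < m}" using M by (intro psubset_card_mono) auto
  qed (use that M in auto)
  have "odd (\<Sum>m'\<in>{m'\<in>M. m' < m}. card (approx_fibre M G m'))
      \<longleftrightarrow> odd (\<Sum>m'\<in>{m'\<in>M. m' < m}. card (approx_fibre M F m'))"
  proof -
    have "{k \<in> {m'\<in>M. m' < m}. odd (card (approx_fibre M G k))}
        = {k \<in> {m'\<in>M. m' < m}. odd (card (approx_fibre M F k))}"
      using below by blast
    then show ?thesis using M by (simp add: even_sum_iff)
  qed
  with agree[OF less.prems(2)] show ?case
    by (auto simp: filter_sum_def split[OF F] split[OF G])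
qed

lemma approx_fibre_of_subset:
  assumes "F \<subseteq> M" "m \<in> F"
  shows "approx_fibre M F m = {m}"
  using assms by (auto simp: approx_fibre_def intro: order_antisym)

text \<open>
  The fibre over each \<open>m \<in> F\<close> is odd, hence contains some \<open>q \<in> G\<close>.  If \<open>q\<close> were different from
  \<open>m\<close>, an immediate predecessor of \<open>m\<close> would be an element of \<open>M\<close> above \<open>q\<close> that is not above
  \<open>m\<close>.
\<close>

lemma subset_if_filter_sums_agree:
  fixes M :: "'a::{semilattice_inf, order_bot, t2_space} set"
  assumes K: "compact_semilattice TYPE('a)"
    and M: "finite M" and inf: "\<And>x y. x \<in> M \<Longrightarrow> y \<in> M \<Longrightarrow> inf x y \<in> M"
    and F: "\<And>p. p \<in> F \<Longrightarrow> open {p..}" "F \<subseteq> M"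
    and pred: "\<And>p. p \<in> F \<Longrightarrow> immediate_predecessors p \<subseteq> M"
    and G: "finite G"
    and agree: "\<And>m. m \<in> M \<Longrightarrow> m \<in> filter_sum G \<longleftrightarrow> m \<in> filter_sum F"
  shows "F \<subseteq> G"
proof
  fix m assume m: "m \<in> F"
  then have mM: "m \<in> M" using F by auto
  have "odd (card (approx_fibre M G m)) \<longleftrightarrow> odd (card (approx_fibre M F m))"
    using odd_card_approx_fibre_eq[OF M inf finite_subset[OF F(2) M] G agree mM] .
  then have "odd (card (approx_fibre M G m))"
    using approx_fibre_of_subset[OF F(2) m] by simp
  then have "approx_fibre M G m \<noteq> {}" by auto
  then obtain q where q: "q \<in> G" "q \<le> m" "\<And>k. k \<in> M \<Longrightarrow> q \<le> k \<Longrightarrow> m \<le> k"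
    by (auto simp: approx_fibre_def)
  have "q = m"
  proof (rule ccontr)
    assume "q \<noteq> m"
    then have "q < m" using q(2) by simp
    from le_immediate_predecessor[OF K F(1)[OF m] this]
    obtain x where x: "x \<in> immediate_predecessors m" "q \<le> x" .
    then have "m \<le> x" using q(3) pred[OF m] by blast
    moreover have "x < m" using x(1) by (simp add: immediate_predecessors_def)
    ultimately show False by simp
  qed
  with q(1) show "m \<in> G" by simp
qed

text \<open>
  The open elements are compact, so the set to be closed under meets below is finite precisely
  by modesty.
\<close>

lemma discrete_filter_sums_of_size:
  assumes "compact_modest_semilattice TYPE('a::{semilattice_inf, order_bot, t2_space})"
  shows "discrete {f :: 'a \<Rightarrow> bool. \<exists>F. finite F \<and> card F = n \<and> (\<forall>p\<in>F. open {p..})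
    \<and> f = (\<lambda>x. x \<in> filter_sum F)}" (is "discrete ?D")
proof (rule discreteI)
  fix f assume f: "f \<in> ?D"
  then obtain F where F: "finite F" "card F = n" "\<And>p. p \<in> F \<Longrightarrow> open {p..}"
    and f_eq: "f = (\<lambda>x. x \<in> filter_sum F)" by auto
  have K: "compact_semilattice TYPE('a)"
    using assms by (simp add: compact_modest_semilattice_def)
  have "finite (immediate_predecessors p)" if "p \<in> F" for p
    using assms compact_element_if_open_atLeast[OF K F(3)[OF that]]
    by (simp add: compact_modest_semilattice_def)
  then have "finite (F \<union> (\<Union>p\<in>F. immediate_predecessors p))" using F(1) by simp
  then obtain M where M: "finite M" "F \<union> (\<Union>p\<in>F. immediate_predecessors p) \<subseteq> M"
    and inf: "\<And>x y. x \<in> M \<Longrightarrow> y \<in> M \<Longrightarrow> inf x y \<in> M"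
    using finite_inf_closure by metis
  define N where "N = (\<Inter>m\<in>M. {g :: 'a \<Rightarrow> bool. g m = f m})"
  have "open {g :: 'a \<Rightarrow> bool. g m = f m}" for m
  proof -
    have "{g :: 'a \<Rightarrow> bool. g m = f m} = (\<lambda>g. g m) -` {f m}" by auto
    moreover have "open ((\<lambda>g :: 'a \<Rightarrow> bool. g m) -` {f m})"
      by (intro open_vimage continuous_on_product_coordinates open_discrete)
    ultimately show ?thesis by simp
  qed
  then have "open N" unfolding N_def using M(1) by (intro open_INT) auto
  moreover have "g = f" if g: "g \<in> N" "g \<in> ?D" for g
  proof -
    obtain G where G: "finite G" "card G = n" and g_eq: "g = (\<lambda>x. x \<in> filter_sum G)"
      using g(2) by auto
    have "F \<subseteq> G"
    proof (rule subset_if_filter_sums_agree[OF K M(1) inf F(3) _ _ G(1)])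
      show "m \<in> filter_sum G \<longleftrightarrow> m \<in> filter_sum F" if "m \<in> M" for m
        using g(1) that unfolding N_def f_eq g_eq by auto
    qed (use M(2) in auto)
    then have "F = G" using G F(2) by (simp add: card_subset_eq)
    then show ?thesis by (simp add: f_eq g_eq)
  qed
  moreover have "f \<in> N" by (simp add: N_def)
  ultimately show "f isolated_in ?D"
    unfolding isolated_in_def using f by blast
qed

section \<open>The function space is sigma-discrete\<close>

theorem theorem3p3:
  assumes "compact_modest_semilattice TYPE('a::{semilattice_inf, order_bot, t2_space})"
  shows "sigma_discrete (Cp2 :: ('a \<Rightarrow> bool) set)"
proof -
  have K: "compact_semilattice TYPE('a)" and td: "totally_disconnected (UNIV :: 'a set)"
    using assms by (simp_all add: compact_modest_semilattice_def)
  define D where "D n = {f :: 'a \<Rightarrow> bool. \<exists>F. finite F \<and> card F = n \<and> (\<forall>p\<in>F. open {p..})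
    \<and> f = (\<lambda>x. x \<in> filter_sum F)}" for n
  have clopen: "f \<in> Cp2 \<longleftrightarrow> open {x. f x} \<and> closed {x. f x}" for f :: "'a \<Rightarrow> bool"
  proof
    assume "f \<in> Cp2"
    then have c: "continuous_on UNIV f" by (simp add: Cp2_def)
    have "{x. f x} = f -` {True}" by auto
    then show "open {x. f x} \<and> closed {x. f x}"
      using open_vimage[OF open_discrete c] closed_vimage[OF closed_singleton c] by metis
  next
    assume f: "open {x. f x} \<and> closed {x. f x}"
    have "open (f -` B)" for B
    proof -
      have "f -` B = (if True \<in> B then {x. f x} else {}) \<union> (if False \<in> B then - {x. f x} else {})"
      proof (rule set_eqI)
        show "x \<in> f -` B \<longleftrightarrow> x \<in> (if True \<in> B then {x. f x} else {}) \<union> (if False \<in> B then - {x. f x} else {})" for x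
          by (cases "f x") auto
      qed
      then show ?thesis using f by (auto simp: open_Compl)
    qed
    then show "f \<in> Cp2" by (simp add: Cp2_def continuous_on_open_vimage)
  qed
  have "(\<Union>n. D n) = Cp2"
  proof (intro set_eqI iffI)
    fix f assume "f \<in> (\<Union>n. D n)"
    then have "{x. f x} \<in> filter_sums" unfolding D_def filter_sums_def by auto
    then show "f \<in> Cp2" using filter_sums_clopen[OF K] clopen by blast
  next
    fix f :: "'a \<Rightarrow> bool" assume "f \<in> Cp2"
    then have "{x. f x} \<in> filter_sums" using clopen clopen_imp_filter_sum[OF K td] by blast
    then obtain F where F: "finite F" "\<forall>p\<in>F. open {p..}" "{x. f x} = filter_sum F"
      unfolding filter_sums_def by auto
    from F(3) have "f = (\<lambda>x. x \<in> filter_sum F)" by auto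
    then have "f \<in> D (card F)" unfolding D_def using F(1,2) by blast
    then show "f \<in> (\<Union>n. D n)" by blast
  qed
  moreover have "\<forall>A\<in>range D. discrete A"
    using discrete_filter_sums_of_size[OF assms] unfolding D_def by blast
  ultimately show ?thesis
    unfolding sigma_discrete_def by (intro exI[of _ "range D"]) auto
qed

end
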